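(* Let $M$ be a complete metric space. Then $\mathcal{F}(M)$ has the approximation property if and only if for every compact $K\subset M$ there is a subset $B\subset M$ such that $K\subset B$ and $\mathcal{F}(B)$ has the approximation property.
   Context: All metric spaces come with a distinguished base point $0$. $\mathrm{Lip}_0(M)$ is the Banach space of real-valued Lipschitz functions $f$ on $M$ with $f(0)=0$, normed by the best Lipschitz constant. For $x\in M$ let $\delta(x)\in\mathrm{Lip}_0(M)^*$ be $\delta(x)(f)=f(x)$. The Lipschitz-free space is $\mathcal{F}(M)=\overline{\operatorname{span}}\{\delta(x):x\in M\}\subset\mathrm{Lip}_0(M)^*$ (norm closure). For $N\subset M$, $\mathcal{F}(N)$ is identified with the closed subspace $\overline{\operatorname{span}}\{\delta(x):x\in N\}$ of $\mathcal{F}(M)$ (canonically isometric to the free space over $N\cup\{0\}$). A Banach space $X$ has the approximation property if for every $\varepsilon>0$ and every norm-compact set $W\subset X$ there is a finite-rank bounded linear operator $S:X\to X$ with $\|Sx-x\|\le\varepsilon$ for every $x\in W$. *)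

theory Defs
  imports "HOL-Analysis.Analysis"
begin

class pointed_metric_space = metric_space +
  fixes base_point :: 'a

typedef (overloaded) ('a::pointed_metric_space) lip0 =
  "{f :: 'a \<Rightarrow> real. f base_point = 0 \<and> (\<exists>L. L-lipschitz_on UNIV f)}"
  morphisms lip0_apply Abs_lip0
  by (rule exI[of _ "\<lambda>_. 0"]) (auto intro!: exI[of _ 0] lipschitz_onI)

setup_lifting type_definition_lip0

definition lipschitz_constant :: "('a::metric_space \<Rightarrow> real) \<Rightarrow> real" where
  "lipschitz_constant f = Inf {L. L-lipschitz_on UNIV f}"

lemma lipschitz_constant_le: "L-lipschitz_on UNIV f \<Longrightarrow> lipschitz_constant f \<le> L"
  unfolding lipschitz_constant_def
  by (rule cInf_lower) (auto intro!: bdd_belowI[of _ 0] simp: lipschitz_on_nonneg)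

lemma lipschitz_constant_lipschitz:
  assumes "L-lipschitz_on UNIV f"
  shows "(lipschitz_constant f)-lipschitz_on UNIV f"
proof (rule lipschitz_onI)
  have ne: "{L. L-lipschitz_on UNIV f} \<noteq> {}"
    using assms by auto
  show "0 \<le> lipschitz_constant f"
    unfolding lipschitz_constant_def
    by (rule cInf_greatest[OF ne]) (auto simp: lipschitz_on_nonneg)
  fix x y :: 'a
  show "dist (f x) (f y) \<le> lipschitz_constant f * dist x y"
  proof (cases "x = y")
    case False
    then have pos: "dist x y > 0" by simp
    have "dist (f x) (f y) / dist x y \<le> lipschitz_constant f"
      unfolding lipschitz_constant_def
    proof (rule cInf_greatest[OF ne])
      fix K assume "K \<in> {L. L-lipschitz_on UNIV f}"
      then have "dist (f x) (f y) \<le> K * dist x y"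
        by (auto dest: lipschitz_onD)
      then show "dist (f x) (f y) / dist x y \<le> K"
        using pos by (simp add: pos_divide_le_eq)
    qed
    then show ?thesis
      using pos by (simp add: pos_divide_le_eq)
  qed simp
qed

instantiation lip0 :: (pointed_metric_space) real_normed_vector
begin

lift_definition zero_lip0 :: "'a lip0" is "\<lambda>_. 0"
  by (auto intro!: exI[of _ 0] lipschitz_onI)

lift_definition plus_lip0 :: "'a lip0 \<Rightarrow> 'a lip0 \<Rightarrow> 'a lip0" is "\<lambda>f g x. f x + g x"
  by (auto intro: lipschitz_on_add)

lift_definition minus_lip0 :: "'a lip0 \<Rightarrow> 'a lip0 \<Rightarrow> 'a lip0" is "\<lambda>f g x. f x - g x"
  by (auto intro: lipschitz_on_diff)

lift_definition uminus_lip0 :: "'a lip0 \<Rightarrow> 'a lip0" is "\<lambda>f x. - f x"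
  by auto

lift_definition scaleR_lip0 :: "real \<Rightarrow> 'a lip0 \<Rightarrow> 'a lip0" is "\<lambda>c f x. c * f x"
  using lipschitz_on_cmult_real by fastforce

lift_definition norm_lip0 :: "'a lip0 \<Rightarrow> real" is lipschitz_constant .

definition dist_lip0 :: "'a lip0 \<Rightarrow> 'a lip0 \<Rightarrow> real" where
  "dist_lip0 f g = norm (f - g)"

definition sgn_lip0 :: "'a lip0 \<Rightarrow> 'a lip0" where
  "sgn_lip0 f = inverse (norm f) *\<^sub>R f"

definition uniformity_lip0 :: "('a lip0 \<times> 'a lip0) filter" where
  "uniformity_lip0 = (INF e\<in>{0<..}. principal {(f, g). dist f g < e})"

definition open_lip0 :: "'a lip0 set \<Rightarrow> bool" where
  "open_lip0 U \<longleftrightarrow> (\<forall>f\<in>U. eventually (\<lambda>(f', g). f' = f \<longrightarrow> g \<in> U) uniformity)"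

instance
proof
  fix f g h :: "'a lip0" and a b :: real and U :: "'a lip0 set"
  show "f + g + h = f + (g + h)" "f + g = g + f" "0 + f = f" "- f + f = 0" "f - g = f + - g"
    "a *\<^sub>R (f + g) = a *\<^sub>R f + a *\<^sub>R g" "(a + b) *\<^sub>R f = a *\<^sub>R f + b *\<^sub>R f"
    "a *\<^sub>R b *\<^sub>R f = (a * b) *\<^sub>R f" "1 *\<^sub>R f = f"
    by (transfer, simp add: algebra_simps)+
  show "dist f g = norm (f - g)" "sgn f = inverse (norm f) *\<^sub>R f"
    by (simp_all add: dist_lip0_def sgn_lip0_def)
  show "uniformity = (INF e\<in>{0<..}. principal {(f, g :: 'a lip0). dist f g < e})"
    by (rule uniformity_lip0_def)
  show "open U \<longleftrightarrow> (\<forall>f\<in>U. eventually (\<lambda>(f', g). f' = f \<longrightarrow> g \<in> U) uniformity)"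
    by (rule open_lip0_def)
  show "norm f = 0 \<longleftrightarrow> f = 0"
  proof transfer
    fix f :: "'a \<Rightarrow> real"
    assume f: "f base_point = 0 \<and> (\<exists>L. L-lipschitz_on UNIV f)"
    show "lipschitz_constant f = 0 \<longleftrightarrow> f = (\<lambda>_. 0)"
    proof
      assume "lipschitz_constant f = 0"
      then have "0-lipschitz_on UNIV f"
        using f lipschitz_constant_lipschitz by metis
      then have "dist (f x) (f base_point) \<le> 0 * dist x base_point" for x
        by (rule lipschitz_onD) auto
      then show "f = (\<lambda>_. 0)"
        using f by auto
    next
      assume "f = (\<lambda>_. 0)"
      then have "0-lipschitz_on UNIV f"
        by (auto intro: lipschitz_onI)
      then show "lipschitz_constant f = 0"
        using lipschitz_constant_le lipschitz_constant_lipschitz lipschitz_on_nonneg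
        by (metis order_antisym)
    qed
  qed
  show "norm (f + g) \<le> norm f + norm g"
    by transfer
      (auto intro!: lipschitz_constant_le lipschitz_on_add intro: lipschitz_constant_lipschitz)
  show "norm (a *\<^sub>R f) = \<bar>a\<bar> * norm f"
  proof transfer
    fix a :: real and f :: "'a \<Rightarrow> real"
    assume f: "f base_point = 0 \<and> (\<exists>L. L-lipschitz_on UNIV f)"
    then have lf: "(lipschitz_constant f)-lipschitz_on UNIV f"
      using lipschitz_constant_lipschitz by blast
    have af: "(\<bar>a\<bar> * lipschitz_constant f)-lipschitz_on UNIV (\<lambda>x. a * f x)"
      using lf by (rule lipschitz_on_cmult_real)
    note le = lipschitz_constant_le[OF af]
    note laf = lipschitz_constant_lipschitz[OF af]
    show "lipschitz_constant (\<lambda>x. a * f x) = \<bar>a\<bar> * lipschitz_constant f"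
    proof (cases "a = 0")
      case True
      then show ?thesis
        using le lipschitz_on_nonneg[OF laf] by simp
    next
      case False
      have "(\<bar>inverse a\<bar> * lipschitz_constant (\<lambda>x. a * f x))-lipschitz_on UNIV
              (\<lambda>x. inverse a * (a * f x))"
        using laf by (rule lipschitz_on_cmult_real)
      then have "lipschitz_constant f \<le> \<bar>inverse a\<bar> * lipschitz_constant (\<lambda>x. a * f x)"
        using False by (intro lipschitz_constant_le) (simp add: mult.assoc[symmetric])
      then have "\<bar>a\<bar> * lipschitz_constant f \<le> lipschitz_constant (\<lambda>x. a * f x)"
        using False by (simp add: field_simps abs_inverse)
      then show ?thesis
        using le by simp
    qed
  qed
qed

end

lemma abs_lip0_apply_le: "\<bar>lip0_apply f x\<bar> \<le> norm f * dist x base_point"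
proof transfer
  fix f :: "'a \<Rightarrow> real" and x
  assume f: "f base_point = 0 \<and> (\<exists>L. L-lipschitz_on UNIV f)"
  then have "dist (f x) (f base_point) \<le> lipschitz_constant f * dist x base_point"
    using lipschitz_constant_lipschitz lipschitz_onD by blast
  then show "\<bar>f x\<bar> \<le> lipschitz_constant f * dist x base_point"
    using f by (simp add: dist_real_def)
qed

lift_definition delta :: "'a::pointed_metric_space \<Rightarrow> ('a lip0 \<Rightarrow>\<^sub>L real)" is
  "\<lambda>x f. lip0_apply f x"
proof (rule bounded_linear_intro)
  show "norm (lip0_apply f x) \<le> norm f * dist x base_point" for f and x :: 'a
    using abs_lip0_apply_le by simp
qed (simp_all add: plus_lip0.rep_eq scaleR_lip0.rep_eq)

text \<open>For a subset \<open>B\<close> of the ambient space, the free space over \<open>B\<close> is always taken as a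
  closed subspace of the free space over the whole space \<open>UNIV\<close>.\<close>

definition free_space :: "'a::pointed_metric_space set \<Rightarrow> ('a lip0 \<Rightarrow>\<^sub>L real) set" where
  "free_space B = closure (span (delta ` B))"

text \<open>Operators on a linear subspace \<open>X\<close> are total functions of which only the values on \<open>X\<close>
  matter; they need not extend to bounded operators on the ambient space.\<close>

definition finite_rank_operator_on ::
    "'v::real_normed_vector set \<Rightarrow> ('v \<Rightarrow> 'v) \<Rightarrow> bool" where
  "finite_rank_operator_on X S \<longleftrightarrow>
     S ` X \<subseteq> X \<and>
     (\<forall>x\<in>X. \<forall>y\<in>X. S (x + y) = S x + S y) \<and>
     (\<forall>c. \<forall>x\<in>X. S (c *\<^sub>R x) = c *\<^sub>R S x) \<and>
     (\<exists>C. \<forall>x\<in>X. norm (S x) \<le> C * norm x) \<and>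
     (\<exists>F. finite F \<and> S ` X = span F)"

text \<open>The approximation property of a closed linear subspace \<open>X\<close>, as a Banach space in its own
  right.\<close>

definition approximation_property :: "'v::banach set \<Rightarrow> bool" where
  "approximation_property X \<longleftrightarrow>
     (\<forall>\<epsilon>>0. \<forall>W. compact W \<and> W \<subseteq> X \<longrightarrow>
        (\<exists>S. finite_rank_operator_on X S \<and> (\<forall>x\<in>W. norm (S x - x) \<le> \<epsilon>)))"

end

theory Submission
  imports Defs
begin

text \<open>
  A compact \<open>W\<close> in the free space over \<open>M\<close> can be pushed into the free space over a compact set:
  if finitely supported elements over a finite set \<open>A\<close> approximate \<open>W\<close>, then the adjoint of
  multiplication by a cutoff function that is \<open>1\<close> on \<open>A\<close> and vanishes off a neighbourhood of \<open>A\<close> moves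
  \<open>W\<close> only slightly, because its norm depends on the radius of the neighbourhood and the size of the
  support but not on \<open>A\<close>, so the accuracy of the approximation can be chosen after it. A radial cutoff, whose
  norm is at most \<open>3\<close> at every scale, makes supports bounded; cutoffs at the radii \<open>1 / 2 ^ n\<close> follow.
  The composed operators \<open>U n\<close> converge uniformly on \<open>W\<close> to a map \<open>T\<close> close to the identity, and \<open>T\<close>
  takes values in the free space over the closure \<open>K\<close> of the union of the finite sets, which is compact.

  A finite-rank operator on the free space over \<open>B \<supseteq> K\<close> extends to the whole free space, since its coordinate
  functionals are Lipschitz functions on \<open>B\<close> and these extend to \<open>M\<close>. If \<open>E\<close> extends one that is
  close to the identity on \<open>T ` W\<close>, then \<open>E \<circ> U n\<close> is the required approximation for large \<open>n\<close>,
  with \<open>n\<close> depending on the norm of \<open>E\<close>.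
\<close>

subsection \<open>Coordinates in finite-dimensional subspaces\<close>

text \<open>Induction adds one segment at a time, as a Minkowski sum of two compact sets.
  Compactness is wanted for a positive distance to \<open>0\<close> in the next lemma.\<close>

lemma compact_coordinate_box:
  fixes F :: "'v::real_normed_vector set"
  assumes "finite F"
  shows "compact {(\<Sum>b\<in>F. u b *\<^sub>R b) | u. \<forall>b\<in>F. \<bar>u b\<bar> \<le> 1}"
  using assms
proof induction
  case empty
  then show ?case by simp
next
  case (insert a F)
  let ?S = "{(\<Sum>b\<in>F. u b *\<^sub>R b) | u. \<forall>b\<in>F. \<bar>u b\<bar> \<le> 1}"
  have "compact ((\<lambda>t. t *\<^sub>R a) ` {-1..1})"
    by (intro compact_continuous_image continuous_intros) simp
  then have "compact {x + y | x y. x \<in> (\<lambda>t. t *\<^sub>R a) ` {-1..1} \<and> y \<in> ?S}"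
    using insert.IH by (rule compact_sums)
  also have "{x + y | x y. x \<in> (\<lambda>t. t *\<^sub>R a) ` {-1..1} \<and> y \<in> ?S} =
      {(\<Sum>b\<in>insert a F. u b *\<^sub>R b) | u. \<forall>b\<in>insert a F. \<bar>u b\<bar> \<le> 1}" (is "?L = ?R")
  proof
    show "?L \<subseteq> ?R"
    proof clarify
      fix t :: real and u :: "'v \<Rightarrow> real"
      assume t: "t \<in> {-1..1}" and u: "\<forall>b\<in>F. \<bar>u b\<bar> \<le> 1"
      have "(\<Sum>b\<in>F. (u(a := t)) b *\<^sub>R b) = (\<Sum>b\<in>F. u b *\<^sub>R b)"
        using insert.hyps by (intro sum.cong) auto
      then show "\<exists>w. t *\<^sub>R a + (\<Sum>b\<in>F. u b *\<^sub>R b) = (\<Sum>b\<in>insert a F. w b *\<^sub>R b) \<and>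
          (\<forall>b\<in>insert a F. \<bar>w b\<bar> \<le> 1)"
        using t u insert.hyps by (intro exI[of _ "u(a := t)"]) auto
    qed
  next
    show "?R \<subseteq> ?L"
    proof clarify
      fix u :: "'v \<Rightarrow> real"
      assume u: "\<forall>b\<in>insert a F. \<bar>u b\<bar> \<le> 1"
      have "(\<Sum>b\<in>insert a F. u b *\<^sub>R b) = u a *\<^sub>R a + (\<Sum>b\<in>F. u b *\<^sub>R b)"
        using insert.hyps by simp
      moreover have "u a *\<^sub>R a \<in> (\<lambda>t. t *\<^sub>R a) ` {-1..1}"
        using u by (intro imageI) (auto simp: abs_le_iff)
      moreover have "(\<Sum>b\<in>F. u b *\<^sub>R b) \<in> ?S"
        using u by blast
      ultimately show "\<exists>x y. (\<Sum>b\<in>insert a F. u b *\<^sub>R b) = x + y \<and> x \<in> (\<lambda>t. t *\<^sub>R a) ` {-1..1} \<and> y \<in> ?S"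
        by blast
    qed
  qed
  finally show ?case .
qed

text \<open>Combinations with coefficient \<open>1\<close> at \<open>b\<close> and the others in
  \<open>[-1, 1]\<close> form a compact set, and independence keeps \<open>0\<close> out of it, so
  it has a positive distance \<open>d b\<close> from \<open>0\<close>. Dividing a vector by its
  largest coordinate reduces to this case. The bound later makes coordinate functionals
  Lipschitz.\<close>

lemma representation_bounded:
  fixes F :: "'v::real_normed_vector set"
  assumes fin: "finite F" and ind: "independent F"
  shows "\<exists>C\<ge>0. \<forall>v\<in>span F. \<forall>b\<in>F. \<bar>representation F v b\<bar> \<le> C * norm v"
proof -
  have "\<forall>b\<in>F. \<exists>d>0. \<forall>u. (\<forall>c\<in>F. \<bar>u c\<bar> \<le> 1) \<and> u b = 1 \<longrightarrow> d \<le> norm (\<Sum>c\<in>F. u c *\<^sub>R c)"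
  proof
    fix b assume b: "b \<in> F"
    let ?S = "{(\<Sum>c\<in>F - {b}. u c *\<^sub>R c) | u. \<forall>c\<in>F - {b}. \<bar>u c\<bar> \<le> 1}"
    have "closed ((+) b ` ?S)"
      by (rule compact_imp_closed[OF compact_translation[OF compact_coordinate_box[OF finite_Diff[OF fin]]]])
    moreover have "0 \<notin> (+) b ` ?S"
    proof
      assume "0 \<in> (+) b ` ?S"
      then obtain y where "0 = b + y" "y \<in> ?S"
        by (rule imageE)
      then obtain u where u: "b + (\<Sum>c\<in>F - {b}. u c *\<^sub>R c) = 0"
        by force
      have "(\<Sum>c\<in>F - {b}. (u(b := 1)) c *\<^sub>R c) = (\<Sum>c\<in>F - {b}. u c *\<^sub>R c)"
        by (intro sum.cong) auto
      moreover have "(\<Sum>c\<in>F. (u(b := 1)) c *\<^sub>R c) = (u(b := 1)) b *\<^sub>R b + (\<Sum>c\<in>F - {b}. (u(b := 1)) c *\<^sub>R c)"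
        by (rule sum.remove[OF fin b])
      ultimately have "(\<Sum>c\<in>F. (u(b := 1)) c *\<^sub>R c) = 0"
        using u by simp
      from independentD[OF ind fin subset_refl this b] have "(u(b := 1)) b = 0" .
      then show False by simp
    qed
    ultimately obtain d where d0: "d > 0" and sub: "ball 0 d \<subseteq> - ((+) b ` ?S)"
      using openE[OF open_Compl ComplI] by blast
    have d: "d \<le> dist 0 y" if "y \<in> (+) b ` ?S" for y
    proof (rule ccontr)
      assume "\<not> d \<le> dist 0 y"
      then have "y \<in> ball 0 d" by simp
      then show False using sub that by blast
    qed
    show "\<exists>d>0. \<forall>u. (\<forall>c\<in>F. \<bar>u c\<bar> \<le> 1) \<and> u b = 1 \<longrightarrow> d \<le> norm (\<Sum>c\<in>F. u c *\<^sub>R c)"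
    proof (intro exI[of _ d] conjI allI impI d0)
      fix u :: "'v \<Rightarrow> real"
      assume u: "(\<forall>c\<in>F. \<bar>u c\<bar> \<le> 1) \<and> u b = 1"
      have "(\<Sum>c\<in>F. u c *\<^sub>R c) = u b *\<^sub>R b + (\<Sum>c\<in>F - {b}. u c *\<^sub>R c)"
        by (rule sum.remove[OF fin b])
      then have "(\<Sum>c\<in>F. u c *\<^sub>R c) = b + (\<Sum>c\<in>F - {b}. u c *\<^sub>R c)"
        using u by simp
      moreover have "b + (\<Sum>c\<in>F - {b}. u c *\<^sub>R c) \<in> (+) b ` ?S"
        using u by (intro imageI CollectI exI[of _ u]) simp
      ultimately have "d \<le> dist 0 (\<Sum>c\<in>F. u c *\<^sub>R c)"
        using d by presburger
      then show "d \<le> norm (\<Sum>c\<in>F. u c *\<^sub>R c)"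
        by simp
    qed
  qed
  from bchoice[OF this] obtain d where d: "\<And>b. b \<in> F \<Longrightarrow> d b > (0::real)"
    "\<And>b u. b \<in> F \<Longrightarrow> (\<forall>c\<in>F. \<bar>u c\<bar> \<le> 1) \<Longrightarrow> u b = 1 \<Longrightarrow> d b \<le> norm (\<Sum>c\<in>F. u c *\<^sub>R c)"
    by blast
  \<comment> \<open>A sum rather than a maximum: it dominates every \<open>1 / d b\<close> and is
    nonnegative even for empty \<open>F\<close>.\<close>
  let ?C = "\<Sum>b\<in>F. 1 / d b"
  have dC: "1 / d b \<le> ?C" if "b \<in> F" for b
    using that fin d(1) by (intro member_le_sum) (auto simp: less_imp_le)
  have C0: "0 \<le> ?C"
    using d(1) by (intro sum_nonneg) (auto simp: less_imp_le)
  have "\<bar>representation F v b\<bar> \<le> ?C * norm v" if v: "v \<in> span F" and b: "b \<in> F" for v b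
  proof -
    let ?r = "representation F v"
    \<comment> \<open>\<open>c\<close> will be a coordinate of largest modulus; after division by it
      all coefficients have modulus at most \<open>1\<close>, and the one at \<open>c\<close> is
      \<open>1\<close>.\<close>
    have "Max ((\<lambda>b. \<bar>?r b\<bar>) ` F) \<in> (\<lambda>b. \<bar>?r b\<bar>) ` F"
      using fin b by (intro Max_in) auto
    then obtain c where c1: "c \<in> F" "Max ((\<lambda>b. \<bar>?r b\<bar>) ` F) = \<bar>?r c\<bar>"
      by auto
    have c: "c \<in> F" "\<And>b. b \<in> F \<Longrightarrow> \<bar>?r b\<bar> \<le> \<bar>?r c\<bar>"
      using c1 fin Max_ge[of "(\<lambda>b. \<bar>?r b\<bar>) ` F"] by auto
    show ?thesis
    proof (cases "?r c = 0")
      case True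
      then show ?thesis using c(2)[OF b] C0 by simp
    next
      case False
      have "d c \<le> norm (\<Sum>b\<in>F. (?r b / ?r c) *\<^sub>R b)"
        using c False by (intro d(2)[OF c(1)]) (auto simp: divide_le_eq)
      also have "(\<Sum>b\<in>F. (?r b / ?r c) *\<^sub>R b) = (1 / ?r c) *\<^sub>R (\<Sum>b\<in>F. ?r b *\<^sub>R b)"
        by (simp add: scaleR_sum_right)
      also have "(\<Sum>b\<in>F. ?r b *\<^sub>R b) = v"
        using ind v fin by (intro sum_representation_eq) auto
      finally have "\<bar>?r c\<bar> \<le> (1 / d c) * norm v"
        using False d(1)[OF c(1)] by (simp add: field_simps)
      also have "\<dots> \<le> ?C * norm v"
        using dC[OF c(1)] by (intro mult_right_mono) auto
      finally show ?thesis using c(2)[OF b] by linarith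
    qed
  qed
  then show ?thesis using C0 by blast
qed

subsection \<open>Lipschitz functions and operators on free spaces\<close>

text \<open>McShane's formula: an infimum of the cones \<open>f y + L * dist x y\<close>, each
  \<open>L\<close>-Lipschitz in \<open>x\<close>. The Lipschitz condition on \<open>X\<close> bounds
  the cones below and makes the infimum at a point of \<open>X\<close> equal to the value of
  \<open>f\<close> there.\<close>

lemma mcshane_extension:
  fixes f :: "'a::metric_space \<Rightarrow> real"
  assumes "L-lipschitz_on X f"
  shows "\<exists>g. L-lipschitz_on UNIV g \<and> (\<forall>x\<in>X. g x = f x)"
proof (cases "X = {}")
  case True
  then show ?thesis
    using lipschitz_on_nonneg[OF assms] by (auto intro!: exI[of _ "\<lambda>_. 0"] lipschitz_onI)
next
  case False
  have L: "0 \<le> L"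
    using assms by (rule lipschitz_on_nonneg)
  have lip: "\<bar>f x - f y\<bar> \<le> L * dist x y" if "x \<in> X" "y \<in> X" for x y
    using lipschitz_onD[OF assms that] by (simp add: dist_real_def)
  define g where "g x = (INF y\<in>X. f y + L * dist x y)" for x
  obtain z where z: "z \<in> X"
    using False by blast
  have bdd: "bdd_below ((\<lambda>y. f y + L * dist x y) ` X)" for x
  proof (rule bdd_belowI2)
    fix y assume y: "y \<in> X"
    have "L * dist z y \<le> L * (dist x z + dist x y)"
      using L by (intro mult_left_mono) (simp_all add: dist_triangle3)
    then show "f z - L * dist x z \<le> f y + L * dist x y"
      using lip[OF z y] by (simp add: algebra_simps abs_le_iff)
  qed
  have ge: "g x \<le> g x' + L * dist x x'" for x x'
  proof -
    have "g x - L * dist x x' \<le> f y + L * dist x' y" if y: "y \<in> X" for y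
    proof -
      have "g x \<le> f y + L * dist x y"
        unfolding g_def by (rule cINF_lower[OF bdd y])
      also have "L * dist x y \<le> L * (dist x x' + dist x' y)"
        using L by (intro mult_left_mono dist_triangle)
      finally show ?thesis by (simp add: algebra_simps)
    qed
    then have "g x - L * dist x x' \<le> g x'"
      unfolding g_def[of x'] using False by (intro cINF_greatest)
    then show ?thesis by simp
  qed
  have "L-lipschitz_on UNIV g"
  proof (rule lipschitz_onI[OF _ L])
    show "dist (g x) (g y) \<le> L * dist x y" for x y
      using ge[of x y] ge[of y x] by (simp add: dist_real_def dist_commute abs_le_iff)
  qed
  moreover have "g x = f x" if x: "x \<in> X" for x
  proof (rule antisym)
    show "g x \<le> f x"
      using cINF_lower[OF bdd x, of x] by (simp add: g_def)
    show "f x \<le> g x"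
      unfolding g_def using False
    proof (rule cINF_greatest)
      show "f x \<le> f y + L * dist x y" if "y \<in> X" for y
        using lip[OF x that] by (simp add: abs_le_iff)
    qed
  qed
  ultimately show ?thesis by blast
qed

lemma finite_subset_of_span:
  fixes D :: "'v::real_vector set"
  assumes "v \<in> span D"
  shows "\<exists>A. finite A \<and> A \<subseteq> D \<and> v \<in> span A"
proof -
  obtain t r where "finite t" "t \<subseteq> D" "v = (\<Sum>a\<in>t. r a *\<^sub>R a)"
    using assms unfolding span_explicit by blast
  then show ?thesis
    by (intro exI[of _ t]) (auto intro: span_sum span_scale span_base)
qed

lemma subspace_closure:
  fixes X :: "'v::real_normed_vector set"
  assumes "subspace X"
  shows "subspace (closure X)"
proof (rule subspaceI)
  show "0 \<in> closure X"
    using subspace_0[OF assms] closure_subset by blast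
next
  fix x y assume "x \<in> closure X" "y \<in> closure X"
  then obtain f g where "\<And>n. f n \<in> X" "f \<longlonglongrightarrow> x" "\<And>n. g n \<in> X" "g \<longlonglongrightarrow> y"
    unfolding closure_sequential by blast
  then show "x + y \<in> closure X"
    unfolding closure_sequential
    by (intro exI[of _ "\<lambda>n. f n + g n"]) (auto intro: subspace_add[OF assms] tendsto_add)
next
  fix c :: real and x assume "x \<in> closure X"
  then obtain f where "\<And>n. f n \<in> X" "f \<longlonglongrightarrow> x"
    unfolding closure_sequential by blast
  then show "c *\<^sub>R x \<in> closure X"
    unfolding closure_sequential
    by (intro exI[of _ "\<lambda>n. c *\<^sub>R f n"]) (auto intro: subspace_scale[OF assms] tendsto_scaleR)
qed

section \<open>Evaluation functionals and free spaces over subsets\<close>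

lemma delta_apply: "blinfun_apply (delta x) f = lip0_apply f x"
  by (simp add: delta.rep_eq)

lemma norm_delta_diff_le: "norm (delta x - delta y) \<le> dist x y"
proof (rule norm_blinfun_bound)
  fix f :: "'a lip0"
  have "(lipschitz_constant (lip0_apply f))-lipschitz_on UNIV (lip0_apply f)"
    using lip0_apply[of f] by (auto intro: lipschitz_constant_lipschitz)
  from lipschitz_onD[OF this, of x y]
  show "norm (blinfun_apply (delta x - delta y) f) \<le> dist x y * norm f"
    by (simp add: blinfun.diff_left delta_apply dist_real_def norm_lip0.rep_eq mult.commute)
qed simp

lemma delta_base_point: "delta base_point = 0"
  using lip0_apply by (intro blinfun_eqI) (auto simp: delta_apply)

lemma subspace_free_space: "subspace (free_space B)"
  unfolding free_space_def by (intro subspace_closure subspace_span)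

lemma free_space_mono: "A \<subseteq> B \<Longrightarrow> free_space A \<subseteq> free_space B"
  unfolding free_space_def by (intro closure_mono span_mono image_mono)

lemma span_delta_subset_free_space: "span (delta ` B) \<subseteq> free_space B"
  unfolding free_space_def by (rule closure_subset)

text \<open>By linearity and continuity it is enough to look at evaluations, as these span a dense
  subspace.\<close>

lemma bounded_linear_image_free_space:
  fixes T :: "('a::pointed_metric_space lip0 \<Rightarrow>\<^sub>L real) \<Rightarrow> 'v::real_normed_vector"
  assumes T: "bounded_linear T" and X: "subspace X" "closed X"
    and mem: "\<And>x. x \<in> B \<Longrightarrow> T (delta x) \<in> X"
  shows "T ` free_space B \<subseteq> X"
proof -
  interpret bounded_linear T by fact
  have "T ` span (delta ` B) = span (T ` delta ` B)"
    by (simp add: linear_span_image linear_axioms)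
  also have "\<dots> \<subseteq> X"
    using mem X(1) by (intro span_minimal) auto
  finally show ?thesis
    unfolding free_space_def
    using X(2) by (intro image_closure_subset linear_continuous_on T)
qed

section \<open>Multiplication by a weight and its adjoint\<close>

lemma lip0_lipschitz: "(norm f)-lipschitz_on UNIV (lip0_apply f)"
  using lip0_apply[of f] by (auto simp: norm_lip0.rep_eq intro: lipschitz_constant_lipschitz)

lemma lip0_apply_Abs:
  "g base_point = 0 \<Longrightarrow> L-lipschitz_on UNIV g \<Longrightarrow> lip0_apply (Abs_lip0 g) = g"
  by (intro Abs_lip0_inverse) auto

text \<open>Product rule. \<open>f\<close> may be unbounded, but where \<open>h\<close> does not
  vanish it is at most \<open>r * norm f\<close> in modulus, and this bound multiplies the slope
  \<open>l\<close> of \<open>h\<close>.\<close>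

lemma lipschitz_on_weighted:
  fixes h :: "'a::pointed_metric_space \<Rightarrow> real" and f :: "'a lip0"
  assumes h: "\<And>x. 0 \<le> h x" "\<And>x. h x \<le> 1" and lip: "l-lipschitz_on UNIV h"
    and supp: "\<And>x. h x \<noteq> 0 \<Longrightarrow> dist x base_point \<le> r" and r: "0 \<le> r"
  shows "((1 + r * l) * norm f)-lipschitz_on UNIV (\<lambda>x. h x * lip0_apply f x)"
proof (rule lipschitz_onI)
  let ?f = "lip0_apply f"
  have l: "0 \<le> l"
    using lip by (rule lipschitz_on_nonneg)
  then show "0 \<le> (1 + r * l) * norm f"
    using r by simp
  \<comment> \<open>The splitting puts the factor \<open>?f y\<close> on the difference of
    \<open>h\<close>, so \<open>y\<close> has to lie where \<open>h\<close> does not vanish;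
    otherwise \<open>x\<close> and \<open>y\<close> are swapped below.\<close>
  have main: "\<bar>h x * ?f x - h y * ?f y\<bar> \<le> (1 + r * l) * norm f * dist x y" if y: "h y \<noteq> 0" for x y
  proof -
    have "\<bar>?f x - ?f y\<bar> \<le> norm f * dist x y"
      using lipschitz_onD[OF lip0_lipschitz[of f], of x y] by (simp add: dist_real_def)
    then have 1: "\<bar>h x\<bar> * \<bar>?f x - ?f y\<bar> \<le> 1 * (norm f * dist x y)"
      using h by (intro mult_mono) auto
    have "\<bar>?f y\<bar> \<le> norm f * r"
      using abs_lip0_apply_le[of f y] supp[OF y] mult_left_mono[OF supp[OF y] norm_ge_zero[of f]]
      by linarith
    moreover have "\<bar>h x - h y\<bar> \<le> l * dist x y"
      using lipschitz_onD[OF lip, of x y] by (simp add: dist_real_def)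
    ultimately have 2: "\<bar>?f y\<bar> * \<bar>h x - h y\<bar> \<le> (norm f * r) * (l * dist x y)"
      using r by (intro mult_mono) auto
    have "h x * ?f x - h y * ?f y = h x * (?f x - ?f y) + ?f y * (h x - h y)"
      by (simp add: algebra_simps)
    also have "\<bar>\<dots>\<bar> \<le> \<bar>h x\<bar> * \<bar>?f x - ?f y\<bar> + \<bar>?f y\<bar> * \<bar>h x - h y\<bar>"
      by (metis abs_mult abs_triangle_ineq)
    also have "\<dots> \<le> (1 + r * l) * norm f * dist x y"
      using 1 2 by (simp add: algebra_simps)
    finally show ?thesis .
  qed
  show "dist (h x * ?f x) (h y * ?f y) \<le> (1 + r * l) * norm f * dist x y" for x y
  proof (cases "h y = 0 \<and> h x = 0")
    case True
    then show ?thesis using r l by simp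
  next
    case False
    then show ?thesis
      using main[of y x] main[of x y] by (auto simp: dist_real_def dist_commute abs_minus_commute)
  qed
qed

text \<open>Multiplication by \<open>h\<close> is a bounded operator \<open>m\<close> on Lipschitz
  functions. \<open>T\<close> is its adjoint, composition with \<open>m\<close>, and evaluation at
  \<open>x\<close> after \<open>m\<close> is \<open>h x\<close> times evaluation at
  \<open>x\<close>.\<close>

lemma weighting_operator:
  fixes h :: "'a::pointed_metric_space \<Rightarrow> real"
  assumes "\<And>x. 0 \<le> h x" "\<And>x. h x \<le> 1" "l-lipschitz_on UNIV h"
    "\<And>x. h x \<noteq> 0 \<Longrightarrow> dist x base_point \<le> r" "0 \<le> r"
  shows "\<exists>T :: ('a lip0 \<Rightarrow>\<^sub>L real) \<Rightarrow> ('a lip0 \<Rightarrow>\<^sub>L real). bounded_linear T \<and>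
    (\<forall>\<mu>. norm (T \<mu>) \<le> (1 + r * l) * norm \<mu>) \<and> (\<forall>x. T (delta x) = h x *\<^sub>R delta x)"
proof -
  define m where "m f = Abs_lip0 (\<lambda>x. h x * lip0_apply f x)" for f
  note lip = lipschitz_on_weighted[OF assms]
  have m: "lip0_apply (m f) = (\<lambda>x. h x * lip0_apply f x)" for f
    unfolding m_def using lip0_apply[of f] by (intro lip0_apply_Abs[OF _ lip]) auto
  have norm_m: "norm (m f) \<le> (1 + r * l) * norm f" for f
    using lip by (simp add: norm_lip0.rep_eq m lipschitz_constant_le)
  have "bounded_linear m"
  proof (rule bounded_linear_intro)
    show "m (f + g) = m f + m g" for f g
      by (simp add: lip0_apply_inject[symmetric] m plus_lip0.rep_eq algebra_simps)
    show "m (c *\<^sub>R f) = c *\<^sub>R m f" for c f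
      by (simp add: lip0_apply_inject[symmetric] m scaleR_lip0.rep_eq algebra_simps)
    show "norm (m f) \<le> norm f * (1 + r * l)" for f
      using norm_m[of f] by (simp add: mult.commute)
  qed
  then have M: "blinfun_apply (Blinfun m) = m"
    by (rule bounded_linear_Blinfun_apply)
  have "0 \<le> 1 + r * l"
    using assms(5) lipschitz_on_nonneg[OF assms(3)] by simp
  then have norm_M: "norm (Blinfun m) \<le> 1 + r * l"
    using norm_m by (intro norm_blinfun_bound) (auto simp: M)
  define T :: "('a lip0 \<Rightarrow>\<^sub>L real) \<Rightarrow> ('a lip0 \<Rightarrow>\<^sub>L real)" where "T \<mu> = \<mu> o\<^sub>L Blinfun m" for \<mu>
  show ?thesis
  proof (intro exI[of _ T] conjI allI)
    show "bounded_linear T"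
      unfolding T_def
      by (rule bounded_bilinear.bounded_linear_left[OF bounded_bilinear_blinfun_compose])
    show "norm (T \<mu>) \<le> (1 + r * l) * norm \<mu>" for \<mu>
      using norm_blinfun_compose[of \<mu> "Blinfun m"] mult_left_mono[OF norm_M norm_ge_zero[of \<mu>]]
      by (simp add: T_def mult.commute)
    show "T (delta x) = h x *\<^sub>R delta x" for x
      by (rule blinfun_eqI) (simp add: T_def M m delta_apply blinfun.scaleR_left)
  qed
qed

text \<open>In a basis \<open>F\<close> of the range, each coordinate of \<open>S (delta x)\<close>
  is a Lipschitz function of \<open>x\<close> on \<open>B\<close>. Its extension \<open>g b\<close>
  gives an element of \<open>lip0\<close>, at which every functional can be evaluated; this defines
  \<open>E\<close> everywhere. Agreement on evaluations passes to their closed span.\<close>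

lemma finite_rank_operator_extension:
  fixes B :: "'a::pointed_metric_space set"
  assumes S: "finite_rank_operator_on (free_space B) S"
  obtains E F where "bounded_linear E" "finite F" "span F \<subseteq> free_space B" "range E \<subseteq> span F"
    "\<And>\<mu>. \<mu> \<in> free_space B \<Longrightarrow> E \<mu> = S \<mu>"
proof -
  let ?X = "free_space B"
  note X = subspace_free_space[of B]
  have maps: "S ` ?X \<subseteq> ?X"
    and add': "\<forall>\<mu>\<in>?X. \<forall>\<nu>\<in>?X. S (\<mu> + \<nu>) = S \<mu> + S \<nu>"
    and scale': "\<forall>c. \<forall>\<mu>\<in>?X. S (c *\<^sub>R \<mu>) = c *\<^sub>R S \<mu>"
    and bdd: "\<exists>C. \<forall>\<mu>\<in>?X. norm (S \<mu>) \<le> C * norm \<mu>"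
    and rank: "\<exists>F. finite F \<and> S ` ?X = span F"
    using S unfolding finite_rank_operator_on_def by - (elim conjE, assumption)+
  note add = add'[rule_format] and scale = scale'[rule_format]
  obtain C0 where C0: "\<And>\<mu>. \<mu> \<in> ?X \<Longrightarrow> norm (S \<mu>) \<le> C0 * norm \<mu>"
    using bdd by blast
  \<comment> \<open>The given bound may be negative if the space is trivial, while
    \<open>D * C\<close> has to be a Lipschitz constant.\<close>
  define C where "C = \<bar>C0\<bar>"
  have C: "0 \<le> C" "\<And>\<mu>. \<mu> \<in> ?X \<Longrightarrow> norm (S \<mu>) \<le> C * norm \<mu>"
  proof -
    show "norm (S \<mu>) \<le> C * norm \<mu>" if "\<mu> \<in> ?X" for \<mu>
      using C0[OF that] mult_right_mono[OF abs_ge_self[of C0] norm_ge_zero[of \<mu>]]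
      unfolding C_def by linarith
  qed (simp add: C_def)
  have diff: "S (\<mu> - \<nu>) = S \<mu> - S \<nu>" if "\<mu> \<in> ?X" "\<nu> \<in> ?X" for \<mu> \<nu>
    using add[OF that(1) subspace_scale[OF X that(2), of "-1"]] scale[OF that(2), of "-1"] by simp
  obtain F0 where F0: "finite F0" "S ` ?X = span F0"
    using rank by blast
  \<comment> \<open>The spanning set in the definition may be dependent; coordinates require a
    basis.\<close>
  obtain F where F: "F \<subseteq> F0" "independent F" "F0 \<subseteq> span F"
    by (rule maximal_independent_subset)
  have fin: "finite F"
    using F(1) F0(1) by (rule finite_subset)
  have SF: "S ` ?X = span F"
    unfolding F0(2) using span_minimal[OF F(3) subspace_span] span_mono[OF F(1)] by (rule subset_antisym)
  then have mem: "S \<mu> \<in> span F" if "\<mu> \<in> ?X" for \<mu>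
    using that by blast
  obtain D where D: "0 \<le> D" "\<And>v b. v \<in> span F \<Longrightarrow> b \<in> F \<Longrightarrow> \<bar>representation F v b\<bar> \<le> D * norm v"
    using representation_bounded[OF fin F(2)] by blast
  \<comment> \<open>With the base point included, the extensions vanish there because
    \<open>delta base_point = 0\<close>, and so belong to \<open>lip0\<close>.\<close>
  let ?B = "insert base_point B"
  have delta_mem: "delta x \<in> ?X" if "x \<in> ?B" for x
  proof (cases "x = base_point")
    case True
    then show ?thesis
      using subspace_0[OF X] by (simp add: delta_base_point)
  next
    case False
    then show ?thesis
      using that span_delta_subset_free_space[of B] span_base[of "delta x" "delta ` B"] by blast
  qed
  have "\<forall>b\<in>F. \<exists>g. (D * C)-lipschitz_on UNIV g \<and>
      (\<forall>x\<in>?B. g x = representation F (S (delta x)) b)"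
  proof
    fix b assume b: "b \<in> F"
    have "(D * C)-lipschitz_on ?B (\<lambda>x. representation F (S (delta x)) b)"
    proof (rule lipschitz_onI)
      show "0 \<le> D * C"
        using C D by simp
      fix x y assume "x \<in> ?B" "y \<in> ?B"
      then have x: "delta x \<in> ?X" and y: "delta y \<in> ?X"
        by (auto intro: delta_mem)
      have "\<bar>representation F (S (delta x)) b - representation F (S (delta y)) b\<bar> =
          \<bar>representation F (S (delta x - delta y)) b\<bar>"
        by (simp add: diff[OF x y] real_vector.representation_diff[OF F(2) mem[OF y] mem[OF x]])
      also have "\<dots> \<le> D * norm (S (delta x - delta y))"
        using mem[OF subspace_diff[OF X x y]] b by (rule D(2))
      also have "\<dots> \<le> D * (C * norm (delta x - delta y))"
        using D(1) C(2)[OF subspace_diff[OF X x y]] by (rule mult_left_mono[rotated])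
      also have "\<dots> \<le> D * (C * dist x y)"
        using C(1) D(1) norm_delta_diff_le by (intro mult_left_mono)
      finally show "dist (representation F (S (delta x)) b) (representation F (S (delta y)) b) \<le>
          D * C * dist x y"
        by (simp add: dist_real_def mult.assoc)
    qed
    then show "\<exists>g. (D * C)-lipschitz_on UNIV g \<and>
        (\<forall>x\<in>?B. g x = representation F (S (delta x)) b)"
      by (rule mcshane_extension)
  qed
  from bchoice[OF this] obtain g where g: "\<And>b. b \<in> F \<Longrightarrow> (D * C)-lipschitz_on UNIV (g b)"
    "\<And>b x. b \<in> F \<Longrightarrow> x \<in> ?B \<Longrightarrow> g b x = representation F (S (delta x)) b"
    by blast
  have "S 0 = 0"
    using diff[of 0 0] subspace_0[OF X] by simp
  then have g0: "g b base_point = 0" if "b \<in> F" for b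
    using g(2)[OF that, of base_point] by (simp add: delta_base_point representation_zero)
  define E where "E \<mu> = (\<Sum>b\<in>F. blinfun_apply \<mu> (Abs_lip0 (g b)) *\<^sub>R b)" for \<mu> :: "'a lip0 \<Rightarrow>\<^sub>L real"
  have E: "bounded_linear E"
    unfolding E_def
    by (intro bounded_linear_sum bounded_linear_scaleR_const blinfun.bounded_linear_left)
  have range_E: "E \<mu> \<in> span F" for \<mu>
    unfolding E_def by (intro span_sum span_scale span_base)
  have E_delta: "E (delta x) = S (delta x)" if "x \<in> B" for x
  proof -
    have "E (delta x) = (\<Sum>b\<in>F. representation F (S (delta x)) b *\<^sub>R b)"
      unfolding E_def using that
      by (intro sum.cong) (auto simp: delta_apply lip0_apply_Abs[OF g0 g(1)] g(2))
    also have "\<dots> = S (delta x)"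
      using F(2) mem[OF delta_mem] that fin by (intro sum_representation_eq) auto
    finally show ?thesis .
  qed
  interpret E: bounded_linear E by (rule E)
  have "subspace {\<mu> \<in> ?X. E \<mu> = S \<mu>}"
    using X \<open>S 0 = 0\<close> add scale unfolding subspace_def by (auto simp: E.add E.scaleR E.zero)
  then have "span (delta ` B) \<subseteq> {\<mu> \<in> ?X. E \<mu> = S \<mu>}"
    using E_delta delta_mem by (intro span_minimal) auto
  then have E_span: "E \<mu> = S \<mu>" if "\<mu> \<in> span (delta ` B)" for \<mu>
    using that by blast
  have "E \<mu> = S \<mu>" if \<mu>: "\<mu> \<in> ?X" for \<mu>
  proof -
    obtain \<nu> where \<nu>: "\<And>n. \<nu> n \<in> span (delta ` B)" "\<nu> \<longlonglongrightarrow> \<mu>"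
      using \<mu> unfolding free_space_def closure_sequential by blast
    have \<nu>X: "\<nu> n \<in> ?X" for n
      using \<nu>(1) span_delta_subset_free_space by blast
    \<comment> \<open>\<open>S\<close> is controlled only on the free space over \<open>B\<close>,
      so its continuity is used along a sequence inside that space.\<close>
    have "(\<lambda>n. S (\<nu> n)) \<longlonglongrightarrow> S \<mu>"
    proof (rule LIM_zero_cancel)
      show "(\<lambda>n. S (\<nu> n) - S \<mu>) \<longlonglongrightarrow> 0"
      proof (rule Lim_null_comparison)
        show "\<forall>\<^sub>F n in sequentially. norm (S (\<nu> n) - S \<mu>) \<le> C * norm (\<nu> n - \<mu>)"
          using C(2)[OF subspace_diff[OF X \<nu>X \<mu>]] by (simp add: diff[OF \<nu>X \<mu>])
        have "(\<lambda>n. C * norm (\<nu> n - \<mu>)) \<longlonglongrightarrow> C * norm (\<mu> - \<mu>)"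
          by (intro tendsto_intros \<nu>(2))
        then show "(\<lambda>n. C * norm (\<nu> n - \<mu>)) \<longlonglongrightarrow> 0"
          by simp
      qed
    qed
    moreover have "(\<lambda>n. S (\<nu> n)) \<longlonglongrightarrow> E \<mu>"
      using E.tendsto[OF \<nu>(2)] by (simp add: E_span[OF \<nu>(1)])
    ultimately show ?thesis
      by (rule LIMSEQ_unique[rotated])
  qed
  moreover have "span F \<subseteq> ?X"
    using maps SF by simp
  moreover have "range E \<subseteq> span F"
    using range_E by blast
  ultimately show thesis
    using E fin by (intro that)
qed

subsection \<open>Compact reduction\<close>

text \<open>Abstracts the adjoint of multiplication by a function equal to \<open>1\<close> on \<open>A\<close> and to \<open>0\<close> off \<open>N\<close>.\<close>

definition cutoff_operator ::
    "real \<Rightarrow> 'a::pointed_metric_space set \<Rightarrow> 'a set \<Rightarrow>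
     (('a lip0 \<Rightarrow>\<^sub>L real) \<Rightarrow> ('a lip0 \<Rightarrow>\<^sub>L real)) \<Rightarrow> bool" where
  "cutoff_operator c A N T \<longleftrightarrow>
     bounded_linear T \<and> (\<forall>\<mu>. norm (T \<mu>) \<le> c * norm \<mu>) \<and>
     (\<forall>x\<in>A. T (delta x) = delta x) \<and> (\<forall>C. T ` free_space C \<subseteq> free_space (C \<inter> N))"

lemma cutoff_operatorD:
  assumes "cutoff_operator c A N T"
  shows "bounded_linear T" "norm (T \<mu>) \<le> c * norm \<mu>" "x \<in> A \<Longrightarrow> T (delta x) = delta x"
    "T ` free_space C \<subseteq> free_space (C \<inter> N)"
  using assms by (simp_all add: cutoff_operator_def)

text \<open>The weight \<open>max 0 (1 - u x / d)\<close> is \<open>1\<close> where \<open>u\<close>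
  vanishes, \<open>0\<close> where \<open>u x \<ge> d\<close>, and has slope at most
  \<open>1 / d\<close>. Both cutoffs below are instances, for two choices of
  \<open>u\<close>.\<close>

lemma cutoff_operator_sublevel:
  fixes u :: "'a::pointed_metric_space \<Rightarrow> real"
  assumes nonneg: "\<And>x. 0 \<le> u x" and lip: "\<And>x y. \<bar>u x - u y\<bar> \<le> dist x y"
    and d: "0 < d" and r: "0 \<le> r" and supp: "\<And>x. u x < d \<Longrightarrow> dist x base_point \<le> r"
  shows "\<exists>T. cutoff_operator (1 + r / d) {x. u x = 0} {x. u x < d} T"
proof -
  define h where "h x = max 0 (1 - u x / d)" for x
  have h0: "u x < d" if "h x \<noteq> 0" for x
    using that d by (auto simp: h_def max_def field_simps split: if_splits)
  have "\<exists>T. bounded_linear T \<and> (\<forall>\<mu>. norm (T \<mu>) \<le> (1 + r * (1 / d)) * norm \<mu>) \<and>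
      (\<forall>x. T (delta x) = h x *\<^sub>R delta x)"
  proof (rule weighting_operator)
    show "0 \<le> h x" "h x \<le> 1" for x
      using nonneg[of x] d by (auto simp: h_def)
    show "(1 / d)-lipschitz_on UNIV h"
    proof (rule lipschitz_onI)
      show "dist (h x) (h y) \<le> 1 / d * dist x y" for x y
      proof -
        have "\<bar>h x - h y\<bar> \<le> \<bar>u x / d - u y / d\<bar>"
          unfolding h_def by linarith
        also have "\<dots> = \<bar>u x - u y\<bar> / d"
          using d by (simp add: diff_divide_distrib[symmetric])
        also have "\<dots> \<le> dist x y / d"
          using lip d by (intro divide_right_mono) auto
        finally show ?thesis by (simp add: dist_real_def)
      qed
    qed (use d in simp)
    show "dist x base_point \<le> r" if "h x \<noteq> 0" for x
      using h0[OF that] by (rule supp)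
  qed (rule r)
  then obtain T where T: "bounded_linear T" "\<And>\<mu>. norm (T \<mu>) \<le> (1 + r / d) * norm \<mu>"
    "\<And>x. T (delta x) = h x *\<^sub>R delta x"
    by auto
  have "T ` free_space C \<subseteq> free_space (C \<inter> {x. u x < d})" for C
  proof (rule bounded_linear_image_free_space[OF T(1) subspace_free_space])
    show "closed (free_space (C \<inter> {x. u x < d}))"
      by (simp add: free_space_def)
    fix x assume x: "x \<in> C"
    show "T (delta x) \<in> free_space (C \<inter> {x. u x < d})"
    proof (cases "h x = 0")
      case True
      then show ?thesis
        using subspace_0[OF subspace_free_space] by (simp add: T(3))
    next
      case False
      then have "delta x \<in> free_space (C \<inter> {x. u x < d})"
        using x h0 span_base[of "delta x" "delta ` (C \<inter> {x. u x < d})"] span_delta_subset_free_space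
        by blast
      then show ?thesis
        using subspace_scale[OF subspace_free_space] by (simp add: T(3))
    qed
  qed
  then have "cutoff_operator (1 + r / d) {x. u x = 0} {x. u x < d} T"
    unfolding cutoff_operator_def using T by (simp add: h_def)
  then show ?thesis by blast
qed

lemma cutoff_operator_mono:
  assumes "cutoff_operator c A N T" "A' \<subseteq> A" "N \<subseteq> N'"
  shows "cutoff_operator c A' N' T"
proof -
  have "T ` free_space C \<subseteq> free_space (C \<inter> N')" for C
  proof (rule order_trans)
    show "T ` free_space C \<subseteq> free_space (C \<inter> N)"
      using assms(1) unfolding cutoff_operator_def by blast
    show "free_space (C \<inter> N) \<subseteq> free_space (C \<inter> N')"
      using assms(3) by (intro free_space_mono Int_mono subset_refl)
  qed
  then show ?thesis
    using assms(1,2) unfolding cutoff_operator_def by (meson subsetD)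
qed

text \<open>Here \<open>u\<close> is the excess over \<open>R\<close> of the distance to the base
  point. The weight falls to \<open>0\<close> over a width \<open>R\<close> inside the ball of
  radius \<open>2 * R\<close>, so the bound \<open>1 + 2 * R / R\<close> does not depend on
  \<open>R\<close>.\<close>

lemma radial_cutoff:
  fixes A :: "'a::pointed_metric_space set"
  assumes "finite A"
  shows "\<exists>N T. bounded N \<and> cutoff_operator 3 A N T"
proof -
  \<comment> \<open>The sum dominates every distance from \<open>A\<close> to the base point; the
    summand \<open>1\<close> keeps \<open>R\<close> positive.\<close>
  define R where "R = 1 + (\<Sum>a\<in>A. dist a base_point)"
  have R: "0 < R"
    unfolding R_def by (intro add_pos_nonneg sum_nonneg) auto
  let ?u = "\<lambda>x :: 'a. max 0 (dist x base_point - R)"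
  have "\<exists>T. cutoff_operator (1 + 2 * R / R) {x. ?u x = 0} {x. ?u x < R} T"
  proof (rule cutoff_operator_sublevel)
    show "\<bar>?u x - ?u y\<bar> \<le> dist x y" for x y
      using dist_triangle[of x base_point y] dist_triangle[of y base_point x]
      by (simp add: dist_commute)
  qed (use R in auto)
  moreover have "1 + 2 * R / R = 3"
    using R by simp
  ultimately obtain T where T: "cutoff_operator 3 {x. ?u x = 0} {x. ?u x < R} T"
    by metis
  have "a \<in> {x. ?u x = 0}" if "a \<in> A" for a
    using member_le_sum[OF that, of "\<lambda>a. dist a base_point"] assms by (simp add: R_def)
  then have "cutoff_operator 3 A {x. ?u x < R} T"
    by (intro cutoff_operator_mono[OF T]) auto
  moreover have "bounded {x. ?u x < R}"
    unfolding bounded_any_center[where a = base_point]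
    by (intro exI[of _ "2 * R"]) (auto simp: dist_commute)
  ultimately show ?thesis
    by blast
qed

text \<open>Here \<open>u\<close> is the distance to \<open>A\<close>. The constant involves only
  \<open>r\<close> and \<open>d\<close>, so it is known before \<open>A\<close> is chosen inside the
  ball.\<close>

lemma neighbourhood_cutoff:
  fixes A :: "'a::pointed_metric_space set"
  assumes A: "A \<noteq> {}" "A \<subseteq> cball base_point r" and d: "0 < d"
  shows "\<exists>T. cutoff_operator (1 + (r + d) / d) A (\<Union>a\<in>A. ball a d) T"
proof -
  have near: "\<exists>a\<in>A. dist x a < d" if "infdist x A < d" for x
    using that A(1) by (simp add: infdist_notempty cINF_less_iff)
  have "\<exists>T. cutoff_operator (1 + (r + d) / d) {x. infdist x A = 0} {x. infdist x A < d} T"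
  proof (rule cutoff_operator_sublevel)
    show "0 \<le> r + d"
      using A d by (force intro: order_trans[OF zero_le_dist])
    show "dist x base_point \<le> r + d" if x: "infdist x A < d" for x
    proof -
      obtain a where a: "a \<in> A" "dist x a < d"
        using near[OF x] by blast
      then have "dist base_point a \<le> r"
        using A(2) by auto
      then show ?thesis
        using dist_triangle[of x base_point a] a(2) by (simp add: dist_commute)
    qed
  qed (use d in \<open>auto simp: infdist_nonneg infdist_triangle_abs\<close>)
  then obtain T where T: "cutoff_operator (1 + (r + d) / d) {x. infdist x A = 0} {x. infdist x A < d} T"
    by blast
  have "{x. infdist x A < d} \<subseteq> (\<Union>a\<in>A. ball a d)"
    using near by (fastforce simp: dist_commute)
  then have "cutoff_operator (1 + (r + d) / d) A (\<Union>a\<in>A. ball a d) T"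
    by (intro cutoff_operator_mono[OF T]) auto
  then show ?thesis by blast
qed

section \<open>Localization of compact sets near finite sets\<close>

text \<open>Finitely many balls centred in the dense span cover \<open>W\<close>, and each centre
  involves finitely many points.\<close>

lemma finite_delta_net:
  fixes W :: "('a::pointed_metric_space lip0 \<Rightarrow>\<^sub>L real) set"
  assumes W: "compact W" "W \<subseteq> free_space B" and e: "0 < e"
  shows "\<exists>A. finite A \<and> A \<subseteq> B \<and> (\<forall>\<mu>\<in>W. \<exists>\<nu>\<in>span (delta ` A). norm (\<mu> - \<nu>) \<le> e)"
proof -
  have cover: "W \<subseteq> (\<Union>\<nu>\<in>span (delta ` B). ball \<nu> e)"
    using W(2) e by (force simp: free_space_def closure_approachable)
  obtain V where V: "V \<subseteq> span (delta ` B)" "finite V" "W \<subseteq> (\<Union>\<nu>\<in>V. ball \<nu> e)"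
    by (rule compactE_image[OF W(1) _ cover]) auto
  have "\<forall>\<nu>\<in>V. \<exists>A. finite A \<and> A \<subseteq> B \<and> \<nu> \<in> span (delta ` A)"
  proof
    fix \<nu> assume "\<nu> \<in> V"
    from finite_subset_of_span[OF subsetD[OF V(1) this]]
    obtain t where "finite t" "t \<subseteq> delta ` B" "\<nu> \<in> span t"
      by blast
    then show "\<exists>A. finite A \<and> A \<subseteq> B \<and> \<nu> \<in> span (delta ` A)"
      using finite_subset_image[of t delta B] by blast
  qed
  from bchoice[OF this] obtain A where A: "\<And>\<nu>. \<nu> \<in> V \<Longrightarrow> finite (A \<nu>) \<and> A \<nu> \<subseteq> B \<and> \<nu> \<in> span (delta ` A \<nu>)"
    by blast
  show ?thesis
  proof (intro exI[of _ "\<Union>(A ` V)"] conjI ballI)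
    show "finite (\<Union>(A ` V))" "\<Union>(A ` V) \<subseteq> B"
      using A V(2) by blast+
    fix \<mu> assume "\<mu> \<in> W"
    then obtain \<nu> where \<nu>: "\<nu> \<in> V" "dist \<nu> \<mu> < e"
      using V(3) by auto
    then have "\<nu> \<in> span (delta ` \<Union>(A ` V))"
      using A span_mono[of "delta ` A \<nu>" "delta ` \<Union>(A ` V)"] by blast
    then show "\<exists>\<nu>\<in>span (delta ` \<Union>(A ` V)). norm (\<mu> - \<nu>) \<le> e"
      using \<nu>(2) by (intro bexI[of _ \<nu>]) (auto simp: dist_norm norm_minus_commute)
  qed
qed

text \<open>\<open>T\<close> fixes the span of the evaluations on \<open>A\<close>, so it moves a
  point of \<open>W\<close> by at most \<open>c + 1\<close> times its distance to any element of
  that span. Since \<open>c\<close> is given before \<open>A\<close>, the net can be taken fine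
  enough. \<open>P\<close> records what a particular cutoff says about \<open>N\<close>.\<close>

lemma localization_step:
  fixes W :: "('a::pointed_metric_space lip0 \<Rightarrow>\<^sub>L real) set"
  assumes W: "compact W" "W \<subseteq> free_space B" and e: "0 < e" and base: "base_point \<in> B" and c: "0 \<le> c"
    and cutoff: "\<And>A. finite A \<Longrightarrow> base_point \<in> A \<Longrightarrow> A \<subseteq> B \<Longrightarrow> \<exists>N T. P A N \<and> cutoff_operator c A N T"
  obtains A N T where "finite A" "base_point \<in> A" "A \<subseteq> B" "P A N" "cutoff_operator c A N T"
    "\<And>\<mu>. \<mu> \<in> W \<Longrightarrow> \<exists>\<nu>\<in>span (delta ` A). norm (\<mu> - \<nu>) \<le> e"
    "\<And>\<mu>. \<mu> \<in> W \<Longrightarrow> norm (T \<mu> - \<mu>) \<le> e"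
proof -
  define e' where "e' = e / (c + 1)"
  have e': "0 < e'" "(c + 1) * e' = e" "e' \<le> e"
    using e c by (auto simp: e'_def field_simps)
  obtain A0 where A0: "finite A0" "A0 \<subseteq> B" "\<And>\<mu>. \<mu> \<in> W \<Longrightarrow> \<exists>\<nu>\<in>span (delta ` A0). norm (\<mu> - \<nu>) \<le> e'"
    using finite_delta_net[OF W e'(1)] by blast
  \<comment> \<open>This makes the finite set nonempty, as the neighbourhood cutoff requires, and
    keeps the base point in the sets of later steps.\<close>
  let ?A = "insert base_point A0"
  have A: "finite ?A" "base_point \<in> ?A" "?A \<subseteq> B"
    using A0 base by auto
  have net: "\<exists>\<nu>\<in>span (delta ` ?A). norm (\<mu> - \<nu>) \<le> e'" if "\<mu> \<in> W" for \<mu>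
    using A0(3)[OF that] span_mono[of "delta ` A0" "delta ` ?A"] by blast
  obtain N T where N: "P ?A N" and T: "cutoff_operator c ?A N T"
    using cutoff[OF A] by blast
  interpret T: bounded_linear T
    using T by (rule cutoff_operatorD)
  have close: "norm (T \<mu> - \<mu>) \<le> e" if \<mu>: "\<mu> \<in> W" for \<mu>
  proof -
    obtain \<nu> where \<nu>: "\<nu> \<in> span (delta ` ?A)" "norm (\<mu> - \<nu>) \<le> e'"
      using net[OF \<mu>] by blast
    have "T \<nu> = \<nu>"
      using linear_eq_on[OF T.linear linear_id \<nu>(1)] cutoff_operatorD(3)[OF T] by auto
    then have "T \<mu> - \<mu> = T (\<mu> - \<nu>) - (\<mu> - \<nu>)"
      by (simp add: T.diff)
    then have "norm (T \<mu> - \<mu>) \<le> norm (T (\<mu> - \<nu>)) + norm (\<mu> - \<nu>)"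
      by (metis norm_triangle_ineq4)
    also have "\<dots> \<le> c * norm (\<mu> - \<nu>) + norm (\<mu> - \<nu>)"
      using cutoff_operatorD(2)[OF T] by simp
    also have "\<dots> = (c + 1) * norm (\<mu> - \<nu>)"
      by (simp add: algebra_simps)
    also have "\<dots> \<le> e"
      using mult_left_mono[OF \<nu>(2), of "c + 1"] c e'(2) by simp
    finally show ?thesis .
  qed
  have "\<exists>\<nu>\<in>span (delta ` ?A). norm (\<mu> - \<nu>) \<le> e" if "\<mu> \<in> W" for \<mu>
    using net[OF that] order_trans[OF _ e'(3)] by blast
  then show thesis
    using A N T close by (intro that)
qed

text \<open>Iterates the localization step. The state is a pair \<open>(U, B)\<close>: the operator
  composed so far and a bounded set such that \<open>U\<close> sends \<open>W\<close> into the free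
  space over \<open>B\<close>. The next pair is \<open>T \<circ> U\<close> and the part of
  \<open>B\<close> within \<open>1 / 2 ^ n\<close> of a finite
  \<open>A \<subseteq> B\<close>.\<close>

lemma localization_sequence:
  fixes W :: "('a::pointed_metric_space lip0 \<Rightarrow>\<^sub>L real) set"
  assumes W: "compact W" "W \<subseteq> free_space UNIV" and e: "0 < e"
  obtains U A where
    "\<And>n. bounded_linear (U n)" "\<And>n. U n ` free_space UNIV \<subseteq> free_space UNIV" "\<And>n. finite (A n)"
    "\<And>\<mu>. \<mu> \<in> W \<Longrightarrow> norm (U 0 \<mu> - \<mu>) \<le> e"
    "\<And>n \<mu>. \<mu> \<in> W \<Longrightarrow> norm (U (Suc n) \<mu> - U n \<mu>) \<le> e / 2 ^ n"
    "\<And>n \<mu>. \<mu> \<in> W \<Longrightarrow> \<exists>\<nu>\<in>span (delta ` A n). norm (U n \<mu> - \<nu>) \<le> e / 2 ^ n"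
    "\<And>n m. n < m \<Longrightarrow> A m \<subseteq> (\<Union>a\<in>A n. ball a (1 / 2 ^ n))"
proof -
  \<comment> \<open>Closeness to the identity is asked of the first operator only; each later one is
    compared with its predecessor in \<open>Q\<close>.\<close>
  define P where "P n s \<longleftrightarrow> (case s of (U, B) \<Rightarrow> bounded_linear U \<and>
      U ` free_space UNIV \<subseteq> free_space UNIV \<and> U ` W \<subseteq> free_space B \<and>
      base_point \<in> B \<and> bounded B \<and> (n = 0 \<longrightarrow> (\<forall>\<mu>\<in>W. norm (U \<mu> - \<mu>) \<le> e)))"
    for n :: nat and s :: "(('a lip0 \<Rightarrow>\<^sub>L real) \<Rightarrow> ('a lip0 \<Rightarrow>\<^sub>L real)) \<times> 'a set"
  define Q where "Q n s s' \<longleftrightarrow> (case s of (U, B) \<Rightarrow> case s' of (U', B') \<Rightarrow>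
      \<exists>A. finite A \<and> A \<subseteq> B \<and> B' \<subseteq> B \<inter> (\<Union>a\<in>A. ball a (1 / 2 ^ n)) \<and>
      (\<forall>\<mu>\<in>W. norm (U' \<mu> - U \<mu>) \<le> e / 2 ^ n \<and> (\<exists>\<nu>\<in>span (delta ` A). norm (U \<mu> - \<nu>) \<le> e / 2 ^ n)))"
    for n :: nat and s s' :: "(('a lip0 \<Rightarrow>\<^sub>L real) \<Rightarrow> ('a lip0 \<Rightarrow>\<^sub>L real)) \<times> 'a set"
  have "\<exists>s. \<forall>n. P n (s n) \<and> Q n (s n) (s (Suc n))"
  proof (rule dependent_nat_choice)
    \<comment> \<open>Adding \<open>A\<close> to the bounded set puts the base point into
      it.\<close>
    have cut: "\<exists>N T. (A \<subseteq> N \<and> bounded N) \<and> cutoff_operator 3 A N T" if A: "finite A" for A :: "'a set"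
    proof -
      obtain N T where NT: "bounded N" "cutoff_operator 3 A N T"
        using radial_cutoff[OF A] by blast
      have "bounded (A \<union> N)" "cutoff_operator 3 A (A \<union> N) T"
        using NT A by (auto intro: cutoff_operator_mono finite_imp_bounded)
      then show ?thesis by blast
    qed
    obtain A N T where A: "base_point \<in> A" "A \<subseteq> N \<and> bounded N" and T: "cutoff_operator 3 A N T"
        and close: "\<And>\<mu>. \<mu> \<in> W \<Longrightarrow> norm (T \<mu> - \<mu>) \<le> e"
      by (rule localization_step[where P = "\<lambda>A N. A \<subseteq> N \<and> bounded N", OF W e UNIV_I _ cut]) auto
    then have N: "base_point \<in> N" "bounded N"
      by auto
    have "T ` free_space UNIV \<subseteq> free_space N"
      using cutoff_operatorD(4)[OF T, of UNIV] by simp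
    then have "P 0 (T, N)"
      using N close W(2) free_space_mono[of N UNIV] cutoff_operatorD(1)[OF T] unfolding P_def by auto
    then show "\<exists>s. P 0 s" by blast
  next
    fix s n assume "P n s"
    then obtain U B where s: "s = (U, B)" and U: "bounded_linear U" "U ` free_space UNIV \<subseteq> free_space UNIV"
        "U ` W \<subseteq> free_space B" and B: "base_point \<in> B" "bounded B"
      by (auto simp: P_def)
    \<comment> \<open>\<open>r\<close> depends only on \<open>B\<close>, and the radius
      \<open>?d\<close> only on \<open>n\<close>, so the norm bound of the cutoff is fixed before
      the localization step chooses \<open>A\<close>.\<close>
    obtain r where r: "B \<subseteq> cball base_point r"
      using B(2) unfolding bounded_any_center[where a = base_point] by (auto simp: subset_eq)
    let ?d = "1 / 2 ^ n :: real"
    have "compact (U ` W)"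
      using W(1) by (intro compact_continuous_image linear_continuous_on U(1))
    moreover have "0 < e / 2 ^ n"
      using e by simp
    moreover have "0 \<le> 1 + (r + ?d) / ?d"
    proof -
      have "0 \<le> r"
        using r B(1) by auto
      then show ?thesis by simp
    qed
    moreover have "\<exists>N T. N = (\<Union>a\<in>A. ball a ?d) \<and> cutoff_operator (1 + (r + ?d) / ?d) A N T"
      if "base_point \<in> A" "A \<subseteq> B" for A
      using neighbourhood_cutoff[of A r ?d] that r by auto
    ultimately obtain A N T where A: "finite A" "base_point \<in> A" "A \<subseteq> B" "N = (\<Union>a\<in>A. ball a ?d)"
        and T: "cutoff_operator (1 + (r + ?d) / ?d) A N T"
        and near: "\<And>\<mu>. \<mu> \<in> U ` W \<Longrightarrow> \<exists>\<nu>\<in>span (delta ` A). norm (\<mu> - \<nu>) \<le> e / 2 ^ n"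
          "\<And>\<mu>. \<mu> \<in> U ` W \<Longrightarrow> norm (T \<mu> - \<mu>) \<le> e / 2 ^ n"
      by (rule localization_step[where P = "\<lambda>A N. N = (\<Union>a\<in>A. ball a ?d)", OF _ U(3) _ B(1)])
        (assumption | rule that; assumption)+
    let ?B = "B \<inter> (\<Union>a\<in>A. ball a ?d)"
    note T' = cutoff_operatorD[OF T]
    have "P (Suc n) (T \<circ> U, ?B)"
    proof -
      have "bounded_linear (T \<circ> U)"
        using bounded_linear_compose[OF T'(1) U(1)] by (simp add: o_def)
      moreover have "(T \<circ> U) ` free_space UNIV \<subseteq> free_space UNIV"
        unfolding image_comp[symmetric]
        using image_mono[OF U(2)] T'(4)[of UNIV] free_space_mono[OF subset_UNIV]
        by (meson order_trans)
      moreover have "(T \<circ> U) ` W \<subseteq> free_space ?B"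
        unfolding image_comp[symmetric] A(4)[symmetric]
        using image_mono[OF U(3)] T'(4) by (rule order_trans)
      moreover have "base_point \<in> ?B"
        using A(2) B(1) by (auto intro!: bexI[of _ base_point])
      moreover have "bounded ?B"
        using B(2) by (rule bounded_subset) blast
      ultimately show ?thesis
        by (simp add: P_def)
    qed
    moreover have "Q n s (T \<circ> U, ?B)"
      unfolding Q_def s using A near by (auto intro!: exI[of _ A])
    ultimately show "\<exists>s'. P (Suc n) s' \<and> Q n s s'"
      by blast
  qed
  then obtain s where P: "\<And>n. P n (s n)" and Q: "\<And>n. Q n (s n) (s (Suc n))"
    by blast
  define U where "U n = fst (s n)" for n
  define B where "B n = snd (s n)" for n
  have s: "s n = (U n, B n)" for n
    by (simp add: U_def B_def)
  have "\<forall>n. \<exists>A. finite A \<and> A \<subseteq> B n \<and> B (Suc n) \<subseteq> B n \<inter> (\<Union>a\<in>A. ball a (1 / 2 ^ n)) \<and>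
      (\<forall>\<mu>\<in>W. norm (U (Suc n) \<mu> - U n \<mu>) \<le> e / 2 ^ n \<and>
        (\<exists>\<nu>\<in>span (delta ` A). norm (U n \<mu> - \<nu>) \<le> e / 2 ^ n))"
    using Q by (simp add: Q_def s)
  from choice[OF this] obtain A where A: "\<forall>n. finite (A n) \<and> A n \<subseteq> B n \<and>
      B (Suc n) \<subseteq> B n \<inter> (\<Union>a\<in>A n. ball a (1 / 2 ^ n)) \<and>
      (\<forall>\<mu>\<in>W. norm (U (Suc n) \<mu> - U n \<mu>) \<le> e / 2 ^ n \<and>
        (\<exists>\<nu>\<in>span (delta ` A n). norm (U n \<mu> - \<nu>) \<le> e / 2 ^ n))"
    by (rule exE)
  have AB: "A n \<subseteq> B n" and BA: "B (Suc n) \<subseteq> B n \<inter> (\<Union>a\<in>A n. ball a (1 / 2 ^ n))" for n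
    using A by blast+
  show thesis
  proof (rule that[of U A])
    show "A m \<subseteq> (\<Union>a\<in>A n. ball a (1 / 2 ^ n))" if "n < m" for n m
    proof -
      \<comment> \<open>The sets decrease, and the cut to the neighbourhood of \<open>A n\<close>
        takes effect at index \<open>Suc n\<close>; hence the strict inequality.\<close>
      have "B m \<subseteq> B (Suc n)"
      proof (rule lift_Suc_antimono_le[of B])
        show "B (Suc k) \<subseteq> B k" for k
          using BA[of k] by blast
        show "Suc n \<le> m"
          using that by simp
      qed
      then show ?thesis
        using AB[of m] BA[of n] by blast
    qed
    show "bounded_linear (U n)" "U n ` free_space UNIV \<subseteq> free_space UNIV" for n
      using P[of n] unfolding P_def s by (simp_all only: prod.case)
    show "norm (U 0 \<mu> - \<mu>) \<le> e" if "\<mu> \<in> W" for \<mu>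
      using P[of 0] that unfolding P_def s by simp
  qed (use A in blast)+
qed

text \<open>The sets up to \<open>A n\<close> form a finite net, as every later one lies within
  \<open>1 / 2 ^ n\<close> of \<open>A n\<close>. Completeness of the space then gives
  compactness.\<close>

lemma compact_closure_Union_nested:
  fixes A :: "nat \<Rightarrow> 'a::complete_space set"
  assumes fin: "\<And>n. finite (A n)" and near: "\<And>n m. n < m \<Longrightarrow> A m \<subseteq> (\<Union>a\<in>A n. ball a (1 / 2 ^ n))"
  shows "compact (closure (\<Union>n. A n))"
  unfolding compact_eq_totally_bounded
proof (intro conjI allI impI)
  show "complete (closure (\<Union>n. A n))"
    by (simp add: complete_eq_closed)
  fix d :: real assume d: "0 < d"
  \<comment> \<open>Half of \<open>d\<close> leads from the net to the union, the other half to its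
    closure.\<close>
  then obtain n where "(1 / 2) ^ n < d / 2"
    using real_arch_pow_inv[of "d / 2" "1 / 2"] by auto
  then have n: "1 / 2 ^ n < d / 2"
    by (simp add: power_one_over)
  show "\<exists>k. finite k \<and> closure (\<Union>n. A n) \<subseteq> (\<Union>x\<in>k. ball x d)"
  proof (intro exI[of _ "\<Union>m\<le>n. A m"] conjI subsetI)
    show "finite (\<Union>m\<le>n. A m)"
      using fin by blast
    fix x assume "x \<in> closure (\<Union>n. A n)"
    then obtain m y where y: "y \<in> A m" "dist y x < d / 2"
      using d unfolding closure_approachable by (meson UN_E half_gt_zero)
    obtain a where a: "a \<in> (\<Union>m\<le>n. A m)" "dist a y < d / 2"
    proof (cases "m \<le> n")
      case True
      then show ?thesis using y(1) d by (intro that[of y]) auto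
    next
      case False
      then obtain a where "a \<in> A n" "dist a y < 1 / 2 ^ n"
        using near[of n m] y(1) by auto
      then show ?thesis using n by (intro that[of a]) auto
    qed
    have "dist a x < d"
      using dist_triangle[of a x y] y(2) a(2) by simp
    then show "x \<in> (\<Union>x\<in>(\<Union>m\<le>n. A m). ball x d)"
      using a(1) by auto
  qed
qed

text \<open>\<open>T\<close> is the sum of a telescoping series dominated on \<open>W\<close> by a
  geometric one, so the Weierstrass test gives uniform convergence there. The bound
  \<open>3 * e\<close> is \<open>e\<close> for \<open>U 0\<close> plus \<open>2 * e\<close> for the
  series. Convergence is claimed on \<open>W\<close> only, because the norm bounds of the composed
  cutoffs grow with \<open>n\<close>.\<close>

lemma compact_reduction:
  fixes W :: "('a::{pointed_metric_space, complete_space} lip0 \<Rightarrow>\<^sub>L real) set"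
  assumes W: "compact W" "W \<subseteq> free_space UNIV" and e: "0 < e"
  obtains K T U where "compact K" "compact (T ` W)" "T ` W \<subseteq> free_space K"
    "\<And>\<mu>. \<mu> \<in> W \<Longrightarrow> norm (T \<mu> - \<mu>) \<le> 3 * e"
    "\<And>n. bounded_linear (U n)" "\<And>n. U n ` free_space UNIV \<subseteq> free_space UNIV"
    "uniform_limit W U T sequentially"
proof -
  obtain U A where U: "\<And>n. bounded_linear (U n)" "\<And>n. U n ` free_space UNIV \<subseteq> free_space UNIV"
      and fin: "\<And>n. finite (A n)" and U0: "\<And>\<mu>. \<mu> \<in> W \<Longrightarrow> norm (U 0 \<mu> - \<mu>) \<le> e"
      and step: "\<And>n \<mu>. \<mu> \<in> W \<Longrightarrow> norm (U (Suc n) \<mu> - U n \<mu>) \<le> e / 2 ^ n"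
      and net: "\<And>n \<mu>. \<mu> \<in> W \<Longrightarrow> \<exists>\<nu>\<in>span (delta ` A n). norm (U n \<mu> - \<nu>) \<le> e / 2 ^ n"
      and near: "\<And>n m. n < m \<Longrightarrow> A m \<subseteq> (\<Union>a\<in>A n. ball a (1 / 2 ^ n))"
    by (fact localization_sequence[OF W e])
  let ?K = "closure (\<Union>n. A n)"
  define D where "D n \<mu> = U (Suc n) \<mu> - U n \<mu>" for n \<mu>
  define T where "T \<mu> = U 0 \<mu> + (\<Sum>n. D n \<mu>)" for \<mu>
  have geom: "(\<lambda>n. e / 2 ^ n) sums (2 * e)"
    using sums_mult[OF geometric_sums[of "1 / 2 :: real"], of e]
    by (simp add: power_one_over mult.commute)
  have lim: "uniform_limit W U T sequentially"
  proof -
    have "uniform_limit W (\<lambda>n \<mu>. \<Sum>i<n. D i \<mu>) (\<lambda>\<mu>. \<Sum>i. D i \<mu>) sequentially"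
      using step sums_summable[OF geom] unfolding D_def by (intro Weierstrass_m_test)
    then have "uniform_limit W (\<lambda>n \<mu>. U 0 \<mu> + (\<Sum>i<n. D i \<mu>)) T sequentially"
      unfolding T_def by (intro uniform_limit_add uniform_limit_const)
    moreover have "U 0 \<mu> + (\<Sum>i<n. D i \<mu>) = U n \<mu>" for n \<mu>
      using sum_lessThan_telescope[of "\<lambda>n. U n \<mu>" n] by (simp add: D_def)
    ultimately show ?thesis
      by simp
  qed
  have "continuous_on W T"
    by (rule uniform_limit_theorem[OF always_eventually lim])
      (simp_all add: linear_continuous_on U(1))
  then have TW: "compact (T ` W)"
    using W(1) by (rule compact_continuous_image)
  have TK: "T \<mu> \<in> free_space ?K" if \<mu>: "\<mu> \<in> W" for \<mu>
  proof -
    obtain \<nu> where \<nu>: "\<And>n. \<nu> n \<in> span (delta ` A n)" "\<And>n. norm (U n \<mu> - \<nu> n) \<le> e / 2 ^ n"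
      using bchoice[of UNIV "\<lambda>n \<nu>. \<nu> \<in> span (delta ` A n) \<and> norm (U n \<mu> - \<nu>) \<le> e / 2 ^ n"] net[OF \<mu>]
      by blast
    \<comment> \<open>The approximants \<open>\<nu> n\<close>, supported in \<open>A n\<close>, thus
      share the limit of \<open>U n \<mu>\<close>, which places it in the closed span over
      \<open>?K\<close>.\<close>
    have "(\<lambda>n. U n \<mu> - \<nu> n) \<longlonglongrightarrow> 0"
      by (rule Lim_null_comparison[OF always_eventually summable_LIMSEQ_zero[OF sums_summable[OF geom]]])
        (simp add: \<nu>(2))
    then have "(\<lambda>n. U n \<mu> - (U n \<mu> - \<nu> n)) \<longlonglongrightarrow> T \<mu> - 0"
      by (intro tendsto_diff tendsto_uniform_limitI[OF lim \<mu>])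
    moreover have "\<nu> n \<in> span (delta ` ?K)" for n
    proof -
      have "A n \<subseteq> ?K"
        using closure_subset[of "\<Union>n. A n"] by blast
      from subsetD[OF span_mono[OF image_mono[OF this]] \<nu>(1)] show ?thesis .
    qed
    ultimately show ?thesis
      unfolding free_space_def closure_sequential by (intro exI[of _ \<nu>]) auto
  qed
  have close: "norm (T \<mu> - \<mu>) \<le> 3 * e" if \<mu>: "\<mu> \<in> W" for \<mu>
  proof -
    have "norm (\<Sum>n. D n \<mu>) \<le> 2 * e"
      using geom step[OF \<mu>]
      by (metis D_def norm_suminf_le sums_summable sums_unique)
    then have "norm (U 0 \<mu> - \<mu> + (\<Sum>n. D n \<mu>)) \<le> e + 2 * e"
      using U0[OF \<mu>] by (intro norm_triangle_le add_mono)
    also have "U 0 \<mu> - \<mu> + (\<Sum>n. D n \<mu>) = T \<mu> - \<mu>"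
      unfolding T_def by simp
    finally show ?thesis
      by simp
  qed
  show thesis
    using TK by (intro that[OF compact_closure_Union_nested[OF fin near] TW _ close U lim]) auto
qed

section \<open>Transfer of the approximation property\<close>

text \<open>The definition asks for the image to equal the span of a finite set, not only to lie in
  one. A maximal independent subset \<open>G\<close> of the image spans it and is finite because it
  lies in \<open>span F\<close>.\<close>

lemma finite_rank_operator_onI:
  assumes X: "subspace X" and S: "bounded_linear S" and F: "finite F" "span F \<subseteq> X" "S ` X \<subseteq> span F"
  shows "finite_rank_operator_on X S"
proof -
  interpret S: bounded_linear S by fact
  obtain G where G: "G \<subseteq> S ` X" "independent G" "S ` X \<subseteq> span G"
    using maximal_independent_subset[of "S ` X"] by metis
  have "subspace (S ` X)"
    using S.linear X by (rule linear_subspace_image)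
  then have "S ` X = span G"
    using G(3) span_minimal[OF G(1)] by blast
  moreover have "finite G"
    using independent_span_bound[OF F(1) G(2)] G(1) F(3) by blast
  moreover obtain C where "\<forall>x. norm (S x) \<le> norm x * C"
    using S.bounded by blast
  ultimately show ?thesis
    unfolding finite_rank_operator_on_def using F
    by (auto simp: S.add S.scaleR mult.commute)
qed

text \<open>\<open>T\<close> is a limit on \<open>W\<close> only and is not known to be bounded and
  linear, so its composition with \<open>E\<close> is no candidate. It serves to find
  \<open>B\<close> and \<open>S\<close>; afterwards a bounded linear \<open>U n\<close> replaces
  it.\<close>

lemma approximation_property_compact_reduction:
  assumes AP: "\<And>K :: 'a::{pointed_metric_space, complete_space} set. compact K \<Longrightarrow>
    \<exists>B. K \<subseteq> B \<and> approximation_property (free_space B)"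
  shows "approximation_property (free_space (UNIV :: 'a set))"
  unfolding approximation_property_def
proof (intro allI impI, elim conjE)
  fix \<epsilon> :: real and W :: "('a lip0 \<Rightarrow>\<^sub>L real) set"
  assume \<epsilon>: "0 < \<epsilon>" and W: "compact W" "W \<subseteq> free_space UNIV"
  \<comment> \<open>The five parts: one for replacing \<open>T\<close> by \<open>U n\<close> under
    \<open>E\<close>, one for \<open>E\<close> on the image of \<open>W\<close> under
    \<open>T\<close>, and three for \<open>T\<close> itself.\<close>
  define e where "e = \<epsilon> / 5"
  have e: "0 < e"
    using \<epsilon> by (simp add: e_def)
  obtain K T U where K: "compact K" and TW: "compact (T ` W)" "T ` W \<subseteq> free_space K"
      and T: "\<And>\<mu>. \<mu> \<in> W \<Longrightarrow> norm (T \<mu> - \<mu>) \<le> 3 * e"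
      and U: "\<And>n. bounded_linear (U n)" "\<And>n. U n ` free_space UNIV \<subseteq> free_space UNIV"
      and lim: "uniform_limit W U T sequentially"
    by (fact compact_reduction[OF W e])
  obtain B where B: "K \<subseteq> B" "approximation_property (free_space B)"
    using AP[OF K] by blast
  have TB: "T ` W \<subseteq> free_space B"
    using TW(2) free_space_mono[OF B(1)] by (rule order_trans)
  then obtain S where S: "finite_rank_operator_on (free_space B) S" "\<And>\<mu>. \<mu> \<in> T ` W \<Longrightarrow> norm (S \<mu> - \<mu>) \<le> e"
    using B(2) TW(1) e unfolding approximation_property_def by metis
  obtain E F where E: "bounded_linear E" "finite F" "span F \<subseteq> free_space B" "range E \<subseteq> span F"
      "\<And>\<mu>. \<mu> \<in> free_space B \<Longrightarrow> E \<mu> = S \<mu>"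
    by (fact finite_rank_operator_extension[OF S(1)])
  interpret E: bounded_linear E by (rule E(1))
  obtain C where C: "0 < C" "\<And>\<mu>. norm (E \<mu>) \<le> norm \<mu> * C"
    using E.pos_bounded by blast
  \<comment> \<open>The bound \<open>C\<close> of \<open>E\<close> is already fixed, so
    \<open>n\<close> can be taken so large that \<open>E\<close> magnifies the remaining error to at
    most \<open>e\<close>.\<close>
  obtain n where n: "\<And>\<mu>. \<mu> \<in> W \<Longrightarrow> dist (U n \<mu>) (T \<mu>) < e / C"
    using uniform_limitD[OF lim, of "e / C"] e C(1) by (auto simp: eventually_sequentially)
  show "\<exists>S. finite_rank_operator_on (free_space UNIV) S \<and> (\<forall>\<mu>\<in>W. norm (S \<mu> - \<mu>) \<le> \<epsilon>)"
  proof (intro exI[of _ "\<lambda>\<mu>. E (U n \<mu>)"] conjI ballI)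
    show "finite_rank_operator_on (free_space UNIV) (\<lambda>\<mu>. E (U n \<mu>))"
      using E(2-4) free_space_mono[of B UNIV]
      by (intro finite_rank_operator_onI[of _ _ F] subspace_free_space bounded_linear_compose[OF E(1) U(1)])
        auto
    fix \<mu> assume \<mu>: "\<mu> \<in> W"
    have "norm (E (U n \<mu> - T \<mu>)) \<le> norm (U n \<mu> - T \<mu>) * C"
      by (rule C(2))
    also have "\<dots> \<le> e"
      using n[OF \<mu>] C(1) by (simp add: dist_norm field_simps)
    finally have 1: "norm (E (U n \<mu>) - E (T \<mu>)) \<le> e"
      by (simp add: E.diff)
    have 2: "norm (E (T \<mu>) - T \<mu>) \<le> e"
      using S(2) E(5) TB \<mu> by fastforce
    have "E (U n \<mu>) - \<mu> = (E (U n \<mu>) - E (T \<mu>)) + (E (T \<mu>) - T \<mu>) + (T \<mu> - \<mu>)"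
      by simp
    also have "norm \<dots> \<le> e + e + 3 * e"
      using 1 2 T[OF \<mu>] by (intro norm_triangle_le add_mono)
    finally show "norm (E (U n \<mu>) - \<mu>) \<le> \<epsilon>"
      by (simp add: e_def)
  qed
qed

theorem corollary2p8:
  "approximation_property (free_space (UNIV :: 'a::{pointed_metric_space, complete_space} set)) \<longleftrightarrow>
   (\<forall>K :: 'a set. compact K \<longrightarrow> (\<exists>B. K \<subseteq> B \<and> approximation_property (free_space B)))"
  \<comment> \<open>In the forward direction \<open>B = UNIV\<close> serves every
    \<open>K\<close>.\<close>
  using approximation_property_compact_reduction by blast

end
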